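(* Let $f:\mathbb{R}^n\times\mathbb{R}\to\mathbb{R}$, $(\mathbf{x},t)\mapsto f(\mathbf{x},t)$, be a twice differentiable function, let $\mathbf{M}:\mathbb{R}^n\to\mathbb{R}^{n\times n}$ be a symmetric positive definite metric, let $\alpha>0$, and consider the natural gradient system $$\dot{\mathbf{x}}=\mathbf{h}(\mathbf{x},t)=-\mathbf{M}(\mathbf{x})^{-1}\,\nabla_{\mathbf{x}} f(\mathbf{x},t).$$ Then $f(\cdot,t)$ is geodesically $\alpha$-strongly convex in the metric $\mathbf{M}$ for each $t$ if and only if the natural gradient system is contracting with rate $\alpha$ in the metric $\mathbf{M}$. More specifically, the Riemannian Hessian $\mathbf{H}(\mathbf{x},t)$ of $f(\cdot,t)$ in the metric $\mathbf{M}$ satisfies $$\mathbf{H}=-\tfrac12\left(\mathbf{M}\mathbf{A}+\mathbf{A}^\top\mathbf{M}+\dot{\mathbf{M}}\right),\qquad \mathbf{A}=\frac{\partial\mathbf{h}}{\partial\mathbf{x}}.$$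
   Context: All functions are assumed sufficiently smooth that derivatives of the necessary order exist and are continuous. A metric is a function $\mathbf{M}:\mathbb{R}^n\to\mathbb{R}^{n\times n}$ with symmetric positive definite values. Contraction: $\dot{\mathbf{x}}=\mathbf{h}(\mathbf{x},t)$ is contracting at rate $\alpha>0$ in the metric $\mathbf{M}$ if for all $t\in\mathbb{R}$ and $\mathbf{x}\in\mathbb{R}^n$, $\dot{\mathbf{M}}+\mathbf{A}^\top\mathbf{M}+\mathbf{M}\mathbf{A}\preceq-2\alpha\mathbf{M}$, where $\mathbf{A}(\mathbf{x},t)=\frac{\partial\mathbf{h}}{\partial\mathbf{x}}$ and $\dot{\mathbf{M}}=\sum_i\frac{\partial\mathbf{M}}{\partial x_i}h_i(\mathbf{x},t)$. Riemannian Hessian: for a twice differentiable function $f$ of $\mathbf{x}$ (with $t$ fixed, if present), its Riemannian Hessian $\mathbf{H}$ in the metric $\mathbf{M}$ has entries $H_{ij}=\frac{\partial^2 f}{\partial x_i\partial x_j}-\sum_k\Gamma_{ij}^k\frac{\partial f}{\partial x_k}$, with Christoffel symbols $\Gamma_{ij}^m=\frac12\sum_{k=1}^n M^{mk}\left(\frac{\partial M_{ik}}{\partial x_j}+\frac{\partial M_{jk}}{\partial x_i}-\frac{\partial M_{ij}}{\partial x_k}\right)$, where $M^{ij}=(\mathbf{M}^{-1})_{ij}$. Geodesic $\alpha$-strong convexity of $f$ in the metric $\mathbf{M}$ means $\mathbf{H}(\mathbf{x})\succeq\alpha\mathbf{M}(\mathbf{x})$ for all $\mathbf{x}\in\mathbb{R}^n$.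 *)

theory Defs
  imports "HOL-Analysis.Analysis"
begin

definition partial :: "'n::finite \<Rightarrow> (real ^ 'n \<Rightarrow> 'b::real_normed_vector) \<Rightarrow> real ^ 'n \<Rightarrow> 'b" where
  "partial i g x = vector_derivative (\<lambda>s. g (x + s *\<^sub>R axis i 1)) (at 0)"

definition C1 :: "(real ^ 'n::finite \<Rightarrow> 'b::real_normed_vector) \<Rightarrow> bool" where
  "C1 g \<longleftrightarrow> (\<forall>x. g differentiable (at x)) \<and> (\<forall>i. continuous_on UNIV (partial i g))"

definition C2 :: "(real ^ 'n::finite \<Rightarrow> 'b::real_normed_vector) \<Rightarrow> bool" where
  "C2 g \<longleftrightarrow> C1 g \<and> (\<forall>i. C1 (partial i g))"

definition gradient :: "(real ^ 'n::finite \<Rightarrow> real) \<Rightarrow> real ^ 'n \<Rightarrow> real ^ 'n" where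
  "gradient g x = (\<chi> i. partial i g x)"

definition pos_def :: "real ^ 'n ^ 'n::finite \<Rightarrow> bool" where
  "pos_def X \<longleftrightarrow> transpose X = X \<and> (\<forall>v. v \<noteq> 0 \<longrightarrow> 0 < v \<bullet> (X *v v))"

definition pos_semidef :: "real ^ 'n ^ 'n::finite \<Rightarrow> bool" where
  "pos_semidef X \<longleftrightarrow> transpose X = X \<and> (\<forall>v. 0 \<le> v \<bullet> (X *v v))"

text \<open>The order on matrices in the sense of Loewner; the built-in order on vectors is
  componentwise.\<close>

definition loewner_le :: "real ^ 'n ^ 'n::finite \<Rightarrow> real ^ 'n ^ 'n \<Rightarrow> bool"
    (infix "\<preceq>\<^sub>L" 50) where
  "X \<preceq>\<^sub>L Y \<longleftrightarrow> pos_semidef (Y - X)"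

definition riemannian_metric :: "(real ^ 'n::finite \<Rightarrow> real ^ 'n ^ 'n) \<Rightarrow> bool" where
  "riemannian_metric M \<longleftrightarrow> C1 M \<and> (\<forall>x. pos_def (M x))"

text \<open>\<open>christoffel M m i j x\<close> has upper index \<open>m\<close> and lower indices \<open>i\<close>, \<open>j\<close>.\<close>

definition christoffel ::
    "(real ^ 'n::finite \<Rightarrow> real ^ 'n ^ 'n) \<Rightarrow> 'n \<Rightarrow> 'n \<Rightarrow> 'n \<Rightarrow> real ^ 'n \<Rightarrow> real" where
  "christoffel M m i j x =
     1 / 2 * (\<Sum>k\<in>UNIV. matrix_inv (M x) $ m $ k *
       (partial j (\<lambda>y. M y $ i $ k) x + partial i (\<lambda>y. M y $ j $ k) x
         - partial k (\<lambda>y. M y $ i $ j) x))"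

definition riemannian_hessian ::
    "(real ^ 'n::finite \<Rightarrow> real ^ 'n ^ 'n) \<Rightarrow> (real ^ 'n \<Rightarrow> real) \<Rightarrow> real ^ 'n \<Rightarrow> real ^ 'n ^ 'n" where
  "riemannian_hessian M g x =
     (\<chi> i j. partial i (partial j g) x - (\<Sum>k\<in>UNIV. christoffel M k i j x * partial k g x))"

definition geodesically_strongly_convex ::
    "(real ^ 'n::finite \<Rightarrow> real ^ 'n ^ 'n) \<Rightarrow> real \<Rightarrow> (real ^ 'n \<Rightarrow> real) \<Rightarrow> bool" where
  "geodesically_strongly_convex M \<alpha> g \<longleftrightarrow> (\<forall>x. \<alpha> *\<^sub>R M x \<preceq>\<^sub>L riemannian_hessian M g x)"

text \<open>The derivative of \<open>M\<close> along the vector field \<open>v\<close>.\<close>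

definition metric_dot ::
    "(real ^ 'n::finite \<Rightarrow> real ^ 'n ^ 'n) \<Rightarrow> (real ^ 'n \<Rightarrow> real ^ 'n) \<Rightarrow> real ^ 'n \<Rightarrow> real ^ 'n ^ 'n" where
  "metric_dot M v x = (\<Sum>i\<in>UNIV. v x $ i *\<^sub>R partial i M x)"

definition contracting ::
    "(real ^ 'n::finite \<Rightarrow> real ^ 'n ^ 'n) \<Rightarrow> real \<Rightarrow> (real ^ 'n \<Rightarrow> real \<Rightarrow> real ^ 'n) \<Rightarrow> bool" where
  "contracting M \<alpha> h \<longleftrightarrow>
     (\<forall>t x. let A = jacobian (\<lambda>y. h y t) (at x) in
        metric_dot M (\<lambda>y. h y t) x + transpose A ** M x + M x ** A
          \<preceq>\<^sub>L (- 2 * \<alpha>) *\<^sub>R M x)"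

definition natural_gradient_field ::
    "(real ^ 'n::finite \<Rightarrow> real ^ 'n ^ 'n) \<Rightarrow> (real ^ 'n \<Rightarrow> real \<Rightarrow> real) \<Rightarrow> real ^ 'n \<Rightarrow> real \<Rightarrow> real ^ 'n" where
  "natural_gradient_field M f x t = - (matrix_inv (M x) *v gradient (\<lambda>y. f y t) x)"

end

(* Differentiating M h = - grad f entrywise gives
     (M A)_ij = - f_ij - sum_k (d_j M_ik) h_k.
   Adding the transpose and the derivative of M along h, and using f_ij = f_ji, leaves
     - 2 f_ij - sum_k h_k (d_j M_ik + d_i M_jk - d_k M_ij),
   where substituting h = - M^-1 grad f turns the last sum into Christoffel symbols. *)

theory Submission
  imports Defs
begin

section \<open>Partial derivatives\<close>

lemma has_vector_derivative_along_line:
  assumes "(g has_derivative D) (at (a + u *\<^sub>R v))"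
  shows "((\<lambda>s. g (a + s *\<^sub>R v)) has_vector_derivative D v) (at u)"
proof -
  have line: "((\<lambda>s. a + s *\<^sub>R v) has_vector_derivative v) (at u)"
    by (auto intro!: derivative_eq_intros simp: has_vector_derivative_def)
  show ?thesis
    using vector_derivative_diff_chain_within[OF line has_derivative_at_withinI[OF assms]]
    by (simp add: o_def)
qed

text \<open>\<open>partial\<close> is only a derivative along a line; for differentiable maps this
  reads it off the full derivative, so that the rules for sums and products become
  available.\<close>

lemma partial_eq_has_derivative:
  assumes "(g has_derivative D) (at x)"
  shows "partial i g x = D (axis i 1)"
  unfolding partial_def
  by (intro vector_derivative_at has_vector_derivative_along_line) (simp add: assms)

lemma partial_along_line:
  assumes "g differentiable (at (a + u *\<^sub>R axis i 1))"
  shows "((\<lambda>s. g (a + s *\<^sub>R axis i 1)) has_vector_derivative partial i g (a + u *\<^sub>R axis i 1)) (at u)"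
proof -
  obtain D where D: "(g has_derivative D) (at (a + u *\<^sub>R axis i 1))"
    using assms unfolding differentiable_def by blast
  show ?thesis
    using has_vector_derivative_along_line[OF D] by (simp add: partial_eq_has_derivative[OF D])
qed

lemma partial_along_line_real:
  fixes g :: "real ^ 'n::finite \<Rightarrow> real"
  assumes "\<And>y. g differentiable (at y)"
  shows "((\<lambda>s. g (a + s *\<^sub>R axis i 1)) has_real_derivative partial i g (a + u *\<^sub>R axis i 1)) (at u)"
  using partial_along_line[OF assms] has_real_derivative_iff_has_vector_derivative by blast

text \<open>The mean value theorem is used twice, first in direction \<open>i\<close> on a
  difference of values of \<open>g\<close>, then in direction \<open>j\<close> on
  \<open>partial i g\<close>.\<close>

lemma second_difference_eq_mixed_partial:
  fixes g :: "real ^ 'n::finite \<Rightarrow> real"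
  assumes g: "\<And>y. g differentiable (at y)" and g': "\<And>y. partial i g differentiable (at y)"
    and s: "0 < s"
  obtains \<xi> \<eta> where "0 < \<xi>" "\<xi> < s" "0 < \<eta>" "\<eta> < s"
    "g (x + s *\<^sub>R axis j 1 + s *\<^sub>R axis i 1) - g (x + s *\<^sub>R axis i 1) - g (x + s *\<^sub>R axis j 1) + g x
      = s * s * partial j (partial i g) (x + \<xi> *\<^sub>R axis i 1 + \<eta> *\<^sub>R axis j 1)"
proof -
  \<comment> \<open>The increment of \<open>g\<close> in direction \<open>j\<close>, as a function
    of the displacement in direction \<open>i\<close>; \<open>?\<phi> s - ?\<phi> 0\<close> is the
    second difference.\<close>
  let ?\<phi> = "\<lambda>u. g (x + s *\<^sub>R axis j 1 + u *\<^sub>R axis i 1) - g (x + u *\<^sub>R axis i 1)"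
  have "(?\<phi> has_real_derivative partial i g (x + s *\<^sub>R axis j 1 + u *\<^sub>R axis i 1)
      - partial i g (x + u *\<^sub>R axis i 1)) (at u)" for u
    by (intro DERIV_diff partial_along_line_real g)
  from MVT2[OF s this] obtain \<xi> where \<xi>: "0 < \<xi>" "\<xi> < s"
    "?\<phi> s - ?\<phi> 0 = s * (partial i g (x + \<xi> *\<^sub>R axis i 1 + s *\<^sub>R axis j 1)
       - partial i g (x + \<xi> *\<^sub>R axis i 1))"
    by (auto simp: add_ac)
  have "((\<lambda>v. partial i g (x + \<xi> *\<^sub>R axis i 1 + v *\<^sub>R axis j 1)) has_real_derivative
      partial j (partial i g) (x + \<xi> *\<^sub>R axis i 1 + v *\<^sub>R axis j 1)) (at v)" for v
    by (intro partial_along_line_real g')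
  from MVT2[OF s this] obtain \<eta> where \<eta>: "0 < \<eta>" "\<eta> < s"
    "partial i g (x + \<xi> *\<^sub>R axis i 1 + s *\<^sub>R axis j 1) - partial i g (x + \<xi> *\<^sub>R axis i 1)
      = s * partial j (partial i g) (x + \<xi> *\<^sub>R axis i 1 + \<eta> *\<^sub>R axis j 1)"
    by auto
  show thesis
    by (rule that[OF \<xi>(1,2) \<eta>(1,2)]) (use \<xi>(3) \<eta>(3) in \<open>simp add: algebra_simps\<close>)
qed

text \<open>The second difference over a square of side \<open>s\<close> is symmetric in
  \<open>i\<close> and \<open>j\<close>, so the two mixed partials agree at some points of that
  square; continuity carries this to \<open>x\<close> as the square shrinks.\<close>

lemma mixed_partials_commute:
  fixes g :: "real ^ 'n::finite \<Rightarrow> real"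
  assumes "C2 g"
  shows "partial i (partial j g) x = partial j (partial i g) x"
proof (rule ccontr)
  let ?a = "\<lambda>y. partial i (partial j g) y" and ?b = "\<lambda>y. partial j (partial i g) y"
  \<comment> \<open>Half the supposed gap: a common value within \<open>e\<close> of both sides
    would make the gap smaller than itself.\<close>
  define e where "e = \<bar>?a x - ?b x\<bar> / 2"
  assume "?a x \<noteq> ?b x"
  then have e: "0 < e" by (simp add: e_def)
  have g: "\<And>y. g differentiable (at y)" "\<And>k y. partial k g differentiable (at y)"
    and "continuous_on UNIV ?a" "continuous_on UNIV ?b"
    using assms by (auto simp: C2_def C1_def)
  then obtain d d' where d: "0 < d" "\<And>y. dist y x < d \<Longrightarrow> dist (?a y) (?a x) < e"
    and d': "0 < d'" "\<And>y. dist y x < d' \<Longrightarrow> dist (?b y) (?b x) < e"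
    using e unfolding continuous_on_iff by (metis UNIV_I)
  \<comment> \<open>Two displacements shorter than \<open>s\<close> along the axes move a point by
    less than \<open>2 * s\<close>, hence stay within both radii.\<close>
  define s where "s = min d d' / 2"
  have s: "0 < s" using d d' by (simp add: s_def)
  have near: "dist (x + u *\<^sub>R axis k 1 + v *\<^sub>R axis l 1) x < min d d'"
    if "0 < u" "u < s" "0 < v" "v < s" for u v :: real and k l :: 'n
  proof -
    have "norm (u *\<^sub>R axis k 1 + v *\<^sub>R axis l (1::real)) \<le> u + v"
      by (rule norm_triangle_le) (use that in simp)
    then show ?thesis
      using that by (simp add: dist_norm add.assoc s_def)
  qed
  obtain \<xi> \<eta> where 1: "0 < \<xi>" "\<xi> < s" "0 < \<eta>" "\<eta> < s"
    "g (x + s *\<^sub>R axis j 1 + s *\<^sub>R axis i 1) - g (x + s *\<^sub>R axis i 1) - g (x + s *\<^sub>R axis j 1) + g x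
      = s * s * ?b (x + \<xi> *\<^sub>R axis i 1 + \<eta> *\<^sub>R axis j 1)"
    by (rule second_difference_eq_mixed_partial[OF g s])
  obtain \<xi>' \<eta>' where 2: "0 < \<xi>'" "\<xi>' < s" "0 < \<eta>'" "\<eta>' < s"
    "g (x + s *\<^sub>R axis i 1 + s *\<^sub>R axis j 1) - g (x + s *\<^sub>R axis j 1) - g (x + s *\<^sub>R axis i 1) + g x
      = s * s * ?a (x + \<xi>' *\<^sub>R axis j 1 + \<eta>' *\<^sub>R axis i 1)"
    by (rule second_difference_eq_mixed_partial[OF g s])
  have "s * s * ?b (x + \<xi> *\<^sub>R axis i 1 + \<eta> *\<^sub>R axis j 1) = s * s * ?a (x + \<xi>' *\<^sub>R axis j 1 + \<eta>' *\<^sub>R axis i 1)"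
    unfolding 1(5)[symmetric] 2(5)[symmetric] by (simp add: algebra_simps)
  then have "?b (x + \<xi> *\<^sub>R axis i 1 + \<eta> *\<^sub>R axis j 1) = ?a (x + \<xi>' *\<^sub>R axis j 1 + \<eta>' *\<^sub>R axis i 1)"
    using s by simp
  moreover have "dist (?b (x + \<xi> *\<^sub>R axis i 1 + \<eta> *\<^sub>R axis j 1)) (?b x) < e"
    using near[OF 1(1-4)] d'(2) by simp
  moreover have "dist (?a (x + \<xi>' *\<^sub>R axis j 1 + \<eta>' *\<^sub>R axis i 1)) (?a x) < e"
    using near[OF 2(1-4)] d(2) by simp
  ultimately show False
    unfolding dist_real_def e_def by (smt (verit) field_sum_of_halves)
qed

lemma partial_vec_nth:
  fixes g :: "real ^ 'n::finite \<Rightarrow> 'b::real_normed_vector ^ 'm"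
  assumes "g differentiable (at x)"
  shows "partial i (\<lambda>y. g y $ k) x = partial i g x $ k"
proof -
  obtain D where D: "(g has_derivative D) (at x)"
    using assms unfolding differentiable_def by blast
  then have "((\<lambda>y. g y $ k) has_derivative (\<lambda>v. D v $ k)) (at x)"
    by (rule bounded_linear.has_derivative[OF bounded_linear_vec_nth])
  from partial_eq_has_derivative[OF this] partial_eq_has_derivative[OF D] show ?thesis by simp
qed

lemma differentiable_vec_nth:
  fixes g :: "'a::real_normed_vector \<Rightarrow> 'b::real_normed_vector ^ 'm"
  assumes "g differentiable F"
  shows "(\<lambda>y. g y $ k) differentiable F"
  using assms bounded_linear.has_derivative[OF bounded_linear_vec_nth]
  unfolding differentiable_def by blast

lemma differentiable_vec_iff:
  fixes g :: "real ^ 'n::finite \<Rightarrow> real ^ 'm::finite"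
  shows "g differentiable (at x) \<longleftrightarrow> (\<forall>k. (\<lambda>y. g y $ k) differentiable (at x))"
  unfolding differentiable_componentwise_within[of g]
  by (auto simp: Basis_vec_def inner_axis)

lemma jacobian_nth_nth:
  fixes g :: "real ^ 'n::finite \<Rightarrow> real ^ 'm::finite"
  assumes "g differentiable (at x)"
  shows "jacobian g (at x) $ k $ j = partial j (\<lambda>y. g y $ k) x"
proof -
  have "partial j g x = jacobian g (at x) *v axis j 1"
    using assms by (intro partial_eq_has_derivative) (simp add: jacobian_works)
  then show ?thesis
    by (simp add: partial_vec_nth[OF assms] matrix_vector_mul_component inner_axis)
qed

section \<open>Differentiability of the natural gradient field\<close>

lemma differentiable_prod:
  fixes g :: "'i \<Rightarrow> 'a::real_normed_vector \<Rightarrow> 'b::real_normed_field"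
  assumes "\<And>i. i \<in> I \<Longrightarrow> g i differentiable (at x)"
  shows "(\<lambda>y. \<Prod>i\<in>I. g i y) differentiable (at x)"
proof -
  from assms obtain D where "\<And>i. i \<in> I \<Longrightarrow> (g i has_derivative D i) (at x)"
    unfolding differentiable_def by metis
  from has_derivative_prod[where f = g and f' = D, OF this] show ?thesis
    by (rule differentiableI)
qed

text \<open>By the Leibniz formula the determinant is a finite sum of products of entries.\<close>

lemma differentiable_det:
  fixes B :: "'a::real_normed_vector \<Rightarrow> real ^ 'n ^ 'n::finite"
  assumes "\<And>i j. (\<lambda>y. B y $ i $ j) differentiable (at x)"
  shows "(\<lambda>y. det (B y)) differentiable (at x)"
  unfolding det_def
  by (intro differentiable_sum ballI differentiable_mult differentiable_prod differentiable_const assms) simp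

text \<open>Cramer's rule exhibits the solution as a quotient of determinants.\<close>

lemma differentiable_linear_solution:
  fixes B :: "real ^ 'm::finite \<Rightarrow> real ^ 'n ^ 'n::finite" and b u :: "real ^ 'm \<Rightarrow> real ^ 'n"
  assumes B: "B differentiable (at x)" and b: "b differentiable (at x)"
    and inv: "\<And>y. det (B y) \<noteq> 0" and u: "\<And>y. B y *v u y = b y"
  shows "u differentiable (at x)"
proof -
  have "u y = (\<chi> k. det (\<chi> i j. if j = k then b y $ i else B y $ i $ j) / det (B y))" for y
    using cramer[OF inv] u by blast
  then have k: "(\<lambda>y. u y $ k)
      = (\<lambda>y. det (\<chi> i j. if j = k then b y $ i else B y $ i $ j) / det (B y))" for k
    by (metis (no_types, lifting) vec_lambda_beta)
  have "(\<lambda>y. (if j = k then b y $ i else B y $ i $ j)) differentiable (at x)" for i j k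
    by (cases "j = k") (simp_all add: differentiable_vec_nth B b)
  then show ?thesis
    unfolding differentiable_vec_iff k
    by (intro allI differentiable_divide differentiable_det inv)
       (simp_all add: differentiable_vec_nth B)
qed

section \<open>Invertibility and symmetry of inverses\<close>

lemma pos_def_invertible:
  assumes "pos_def X"
  shows "invertible X"
proof -
  have "v = 0" if "X *v v = 0" for v
    using assms that unfolding pos_def_def by fastforce
  then show ?thesis
    by (metis matrix_left_invertible_ker invertible_left_inverse)
qed

lemma matrix_mult_matrix_inv:
  assumes "invertible X"
  shows "X ** matrix_inv X = mat 1"
  using someI_ex[OF assms[unfolded invertible_def]] unfolding matrix_inv_def by blast

text \<open>Transposing \<open>X ** ?N = mat 1\<close> makes \<open>transpose ?N\<close> a left
  inverse of the symmetric \<open>X\<close>, and a left inverse equals a right inverse.\<close>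

lemma symmetric_matrix_inv:
  fixes X :: "real ^ 'n ^ 'n::finite"
  assumes "invertible X" "transpose X = X"
  shows "transpose (matrix_inv X) = matrix_inv X"
proof -
  let ?N = "matrix_inv X"
  have r: "X ** ?N = mat 1"
    by (rule matrix_mult_matrix_inv[OF assms(1)])
  have "transpose ?N ** X = transpose (X ** ?N)"
    by (simp add: matrix_transpose_mul assms(2))
  then have "transpose ?N ** X = mat 1"
    by (simp add: r)
  then have "(transpose ?N ** X) ** ?N = ?N"
    by simp
  then show ?thesis
    by (simp add: matrix_mul_assoc[symmetric] r)
qed

section \<open>The Hessian identity\<close>

text \<open>Time is only a parameter in the Hessian identity, so it is frozen here: \<open>g\<close>
  stands for one time slice of the objective and \<open>h\<close> for the field at that
  time.\<close>

context
  fixes M :: "real ^ 'n::finite \<Rightarrow> real ^ 'n ^ 'n" and g :: "real ^ 'n \<Rightarrow> real"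
    and h :: "real ^ 'n \<Rightarrow> real ^ 'n"
  assumes M: "riemannian_metric M" and g: "C2 g"
  defines "h \<equiv> \<lambda>x. - (matrix_inv (M x) *v gradient g x)"
begin

lemma metric_differentiable: "M differentiable (at x)"
  using M by (simp add: riemannian_metric_def C1_def)

lemma metric_pos_def: "pos_def (M x)"
  using M by (simp add: riemannian_metric_def)

lemma partial_metric_entry: "partial k (\<lambda>y. M y $ i $ j) x = partial k M x $ i $ j"
  by (simp add: partial_vec_nth metric_differentiable differentiable_vec_nth)

text \<open>This implicit form of the field is the one to differentiate: no derivative of the
  inverse matrix then appears.\<close>

lemma metric_mult_field: "M x *v h x = - gradient g x"
proof -
  have "M x ** matrix_inv (M x) = mat 1"
    using pos_def_invertible[OF metric_pos_def] by (rule matrix_mult_matrix_inv)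
  then show ?thesis
    by (simp add: h_def matrix_vector_mul_assoc linear_neg[OF matrix_vector_mul_linear])
qed

lemma gradient_differentiable: "gradient g differentiable (at x)"
  using g by (simp add: differentiable_vec_iff gradient_def C2_def C1_def)

text \<open>The field solves a linear system with differentiable coefficients and right-hand side.
  This makes \<open>jacobian h\<close> its actual derivative.\<close>

lemma field_differentiable: "h differentiable (at x)"
proof (rule differentiable_linear_solution[OF metric_differentiable _ _ metric_mult_field])
  show "(\<lambda>y. - gradient g y) differentiable (at x)"
    by (intro differentiable_minus gradient_differentiable)
  show "det (M y) \<noteq> 0" for y
    using pos_def_invertible[OF metric_pos_def] by (simp add: invertible_det_nz)
qed

lemma metric_mult_jacobian:
  "(M x ** jacobian h (at x)) $ i $ j
    = - partial j (partial i g) x - (\<Sum>k\<in>UNIV. partial j M x $ i $ k * h x $ k)"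
proof -
  let ?D = "\<lambda>f. frechet_derivative f (at x)"
  have works: "(f has_derivative ?D f) (at x)" if "f differentiable (at x)" for f :: "real ^ 'n \<Rightarrow> real"
    using that frechet_derivative_works by blast
  have p: "?D f (axis j 1) = partial j f x" if "f differentiable (at x)" for f :: "real ^ 'n \<Rightarrow> real"
    using partial_eq_has_derivative[OF works[OF that]] by simp
  have dM: "(\<lambda>y. M y $ i $ k) differentiable (at x)" and dh: "(\<lambda>y. h y $ k) differentiable (at x)" for k
    by (simp_all add: differentiable_vec_nth metric_differentiable field_differentiable)
  have eq: "(\<Sum>k\<in>UNIV. M y $ i $ k * h y $ k) = - partial i g y" for y
    using metric_mult_field[of y] by (simp add: vec_eq_iff matrix_vector_mult_def gradient_def)
  \<comment> \<open>Product rule for row \<open>i\<close> of \<open>M y *v h y\<close>, to be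
    evaluated in direction \<open>axis j 1\<close> and compared with the derivative of
    \<open>- partial i g\<close>.\<close>
  have "((\<lambda>y. \<Sum>k\<in>UNIV. M y $ i $ k * h y $ k) has_derivative
      (\<lambda>v. \<Sum>k\<in>UNIV. M x $ i $ k * ?D (\<lambda>y. h y $ k) v + ?D (\<lambda>y. M y $ i $ k) v * h x $ k)) (at x)"
    by (intro has_derivative_sum has_derivative_mult works dM dh)
  from partial_eq_has_derivative[OF this, of j]
  have "(\<Sum>k\<in>UNIV. M x $ i $ k * partial j (\<lambda>y. h y $ k) x + partial j M x $ i $ k * h x $ k)
      = partial j (\<lambda>y. - partial i g y) x"
    by (simp add: eq p dM dh partial_metric_entry)
  also have "\<dots> = - partial j (partial i g) x"
  proof -
    have d: "partial i g differentiable (at x)"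
      using g by (simp add: C2_def C1_def)
    show ?thesis
      using partial_eq_has_derivative[OF has_derivative_minus[OF works[OF d]]] p[OF d] by simp
  qed
  finally show ?thesis
    by (simp add: matrix_matrix_mult_def jacobian_nth_nth[OF field_differentiable]
        sum.distrib algebra_simps)
qed

text \<open>After exchanging the two sums, symmetry of the inverse metric lets it act on the
  gradient instead of on the derivatives of \<open>M\<close>, and that product is
  \<open>- h x\<close>.\<close>

lemma christoffel_mult_gradient:
  "(\<Sum>k\<in>UNIV. christoffel M k i j x * partial k g x)
    = - (1 / 2) * (\<Sum>k\<in>UNIV. h x $ k
        * (partial j M x $ i $ k + partial i M x $ j $ k - partial k M x $ i $ j))"
proof -
  let ?N = "matrix_inv (M x)"
  let ?c = "\<lambda>l. partial j M x $ i $ l + partial i M x $ j $ l - partial l M x $ i $ j"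
  have "transpose ?N = ?N"
    using pos_def_invertible[OF metric_pos_def] metric_pos_def
    by (intro symmetric_matrix_inv) (auto simp: pos_def_def)
  then have sym: "?N $ k $ l = ?N $ l $ k" for k l
    by (metis transpose_def vec_lambda_beta)
  have "(\<Sum>k\<in>UNIV. christoffel M k i j x * partial k g x)
      = 1 / 2 * (\<Sum>k\<in>UNIV. \<Sum>l\<in>UNIV. ?N $ k $ l * ?c l * partial k g x)"
    by (simp add: christoffel_def partial_metric_entry sum_distrib_right sum_distrib_left mult.assoc)
  also have "\<dots> = 1 / 2 * (\<Sum>l\<in>UNIV. \<Sum>k\<in>UNIV. ?N $ k $ l * ?c l * partial k g x)"
    by (subst sum.swap) (rule refl)
  also have "\<dots> = 1 / 2 * (\<Sum>l\<in>UNIV. (\<Sum>k\<in>UNIV. ?N $ l $ k * partial k g x) * ?c l)"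
  proof -
    have "(\<Sum>k\<in>UNIV. ?N $ k $ l * ?c l * partial k g x) = (\<Sum>k\<in>UNIV. ?N $ l $ k * partial k g x) * ?c l" for l
      unfolding sum_distrib_right by (intro sum.cong refl) (simp only: sym[of _ l] mult_ac)
    then show ?thesis by presburger
  qed
  also have "\<dots> = 1 / 2 * (\<Sum>l\<in>UNIV. - h x $ l * ?c l)"
    by (simp add: h_def matrix_vector_mult_def gradient_def)
  finally show ?thesis
    by (simp add: sum_negf)
qed

lemma riemannian_hessian_eq:
  "riemannian_hessian M g x
    = - (1 / 2) *\<^sub>R (M x ** jacobian h (at x) + transpose (jacobian h (at x)) ** M x + metric_dot M h x)"
proof -
  let ?A = "jacobian h (at x)"
  have "transpose (M x) = M x"
    using metric_pos_def by (simp add: pos_def_def)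
  \<comment> \<open>Symmetry of the metric turns the second product into the transpose of the first,
    so \<open>metric_mult_jacobian\<close> evaluates both.\<close>
  then have "transpose ?A ** M x = transpose (M x ** ?A)"
    by (simp add: matrix_transpose_mul)
  then have T: "(transpose ?A ** M x) $ i $ j = (M x ** ?A) $ j $ i" for i j
    by (simp add: transpose_def)
  have D: "metric_dot M h x $ i $ j = (\<Sum>k\<in>UNIV. h x $ k * partial k M x $ i $ j)" for i j
    by (simp add: metric_dot_def)
  have "riemannian_hessian M g x $ i $ j
      = - (1 / 2) * ((M x ** ?A) $ i $ j + (transpose ?A ** M x) $ i $ j + metric_dot M h x $ i $ j)" for i j
    \<comment> \<open>The two products carry the second partials of \<open>g\<close> in opposite
      orders; commuting one of them lets them add up to twice the Hessian entry.\<close>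
    unfolding T D metric_mult_jacobian mixed_partials_commute[OF g, of j i x]
    by (simp add: riemannian_hessian_def christoffel_mult_gradient
        distrib_left right_diff_distrib sum.distrib sum_subtractf mult.commute[of "h x $ k" for k])
  then show ?thesis
    by (simp add: vec_eq_iff)
qed

end

section \<open>Loewner order and the equivalence with contraction\<close>

lemma pos_semidef_scaleR_iff:
  assumes "0 < c"
  shows "pos_semidef (c *\<^sub>R X) \<longleftrightarrow> pos_semidef X"
proof -
  have "transpose (c *\<^sub>R X) = c *\<^sub>R transpose X"
    by (simp add: transpose_def vec_eq_iff)
  then show ?thesis
    using assms by (simp add: pos_semidef_def scaleR_matrix_vector_assoc[symmetric] zero_le_mult_iff)
qed

theorem theorem1:
  fixes f :: "real ^ 'n::finite \<Rightarrow> real \<Rightarrow> real"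
    and M :: "real ^ 'n \<Rightarrow> real ^ 'n ^ 'n"
    and h :: "real ^ 'n \<Rightarrow> real \<Rightarrow> real ^ 'n"
    and A :: "real ^ 'n \<Rightarrow> real \<Rightarrow> real ^ 'n ^ 'n"
    and \<alpha> :: real
  assumes f: "\<And>t. C2 (\<lambda>x. f x t)"
    and M: "riemannian_metric M"
    and \<alpha>: "0 < \<alpha>"
  defines "h \<equiv> natural_gradient_field M f"
    and "A \<equiv> \<lambda>x t. jacobian (\<lambda>y. h y t) (at x)"
  shows "((\<forall>t. geodesically_strongly_convex M \<alpha> (\<lambda>x. f x t)) \<longleftrightarrow> contracting M \<alpha> h) \<and>
    (\<forall>x t. riemannian_hessian M (\<lambda>y. f y t) x =
       - (1 / 2) *\<^sub>R (M x ** A x t + transpose (A x t) ** M x + metric_dot M (\<lambda>y. h y t) x))"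
proof -
  have H: "riemannian_hessian M (\<lambda>y. f y t) x =
       - (1 / 2) *\<^sub>R (M x ** A x t + transpose (A x t) ** M x + metric_dot M (\<lambda>y. h y t) x)" for x t
    using riemannian_hessian_eq[OF M f, of t x]
    by (simp add: A_def h_def natural_gradient_field_def)
  \<comment> \<open>By the identity, the matrix that contraction requires to be positive
    semidefinite is twice the one in the convexity condition; the positive factor 2 does not affect
    semidefiniteness, so the conditions agree at each \<open>x\<close> and \<open>t\<close>.\<close>
  have scaled: "(- 2 * \<alpha>) *\<^sub>R M x
      - (metric_dot M (\<lambda>y. h y t) x + transpose (A x t) ** M x + M x ** A x t)
      = 2 *\<^sub>R (riemannian_hessian M (\<lambda>y. f y t) x - \<alpha> *\<^sub>R M x)" for x t
    by (simp add: H vec_eq_iff algebra_simps)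
  have "contracting M \<alpha> h \<longleftrightarrow> (\<forall>t. geodesically_strongly_convex M \<alpha> (\<lambda>x. f x t))"
    unfolding contracting_def geodesically_strongly_convex_def loewner_le_def Let_def
      scaled[unfolded A_def]
    by (simp add: pos_semidef_scaleR_iff)
  with H show ?thesis by simp
qed

end
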